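(* Let $P_n$ ($n\ge 1$) and $C_n$ ($n\ge 3$) be the path graph and the cycle graph on $n$ vertices, respectively. Their matching polynomials are $$M_{P_{n}}(x)=\frac{1}{2^{n}}\sum_{k=0}^{\lfloor n/2\rfloor}(-1)^{k}\binom{n+1}{2k+1}x^{n-2k}\left(4-x^{2}\right)^{k},$$ $$M_{C_{n}}(x)=\frac{1}{2^{n-1}}\sum_{k=0}^{\lfloor n/2\rfloor}(-1)^{k}\binom{n}{2k}x^{n-2k}\left(4-x^{2}\right)^{k}.$$
   Context: For a graph $G$ on $n$ vertices, the matching polynomial is $M_G(x)=\sum_{k=0}^{\lfloor n/2\rfloor}(-1)^k m(G,k)x^{n-2k}$, where $m(G,k)$ is the number of matchings of $G$ with exactly $k$ edges (with $m(G,0)=1$). Known fact (Hosoya) used by the paper: $M_{P_n}(x)=U_n(x/2)$ and $M_{C_n}(x)=2T_n(x/2)$, where $U_n$ and $T_n$ are the Chebyshev polynomials of the second and first kind, $U_n(\cos\theta)=\sin((n+1)\theta)/\sin\theta$ and $T_n(\cos\theta)=\cos(n\theta)$. *)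

theory Defs
  imports "HOL-Computational_Algebra.Polynomial"
begin

record 'a ugraph =
  verts :: "'a set"
  edges :: "'a set set"

definition simple_graph :: "'a ugraph \<Rightarrow> bool" where
  "simple_graph G \<longleftrightarrow> finite (verts G) \<and> (\<forall>e \<in> edges G. e \<subseteq> verts G \<and> card e = 2)"

definition matching :: "'a ugraph \<Rightarrow> 'a set set \<Rightarrow> bool" where
  "matching G M \<longleftrightarrow> M \<subseteq> edges G \<and> pairwise disjnt M"

definition num_matchings :: "'a ugraph \<Rightarrow> nat \<Rightarrow> nat" where
  "num_matchings G k = card {M. matching G M \<and> card M = k}"

definition matching_poly :: "'a ugraph \<Rightarrow> real poly" where
  "matching_poly G = (let n = card (verts G) in
     \<Sum>k=0..n div 2. monom ((-1) ^ k * real (num_matchings G k)) (n - 2 * k))"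

definition path_graph :: "nat \<Rightarrow> nat ugraph" where
  "path_graph n = \<lparr> verts = {0..<n}, edges = {{i, Suc i} | i. Suc i < n} \<rparr>"

definition cycle_graph :: "nat \<Rightarrow> nat ugraph" where
  "cycle_graph n = \<lparr> verts = {0..<n}, edges = {{i, Suc i mod n} | i. i < n} \<rparr>"

lemma simple_graph_path: "simple_graph (path_graph n)"
  by (auto simp: simple_graph_def path_graph_def)

text \<open>For \<open>n \<le> 2\<close> the definition of \<^const>\<open>cycle_graph\<close> does not describe a cycle.\<close>

lemma simple_graph_cycle:
  assumes "n \<ge> 3"
  shows "simple_graph (cycle_graph n)"
proof -
  have "i \<noteq> Suc i mod n" if "i < n" for i
    using that assms by (cases "Suc i = n") auto
  then show ?thesis
    using assms by (auto simp: simple_graph_def cycle_graph_def card_insert_if)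
qed

lemma num_matchings_0:
  assumes "simple_graph G"
  shows "num_matchings G 0 = 1"
proof -
  have "edges G \<subseteq> Pow (verts G)"
    using assms by (auto simp: simple_graph_def)
  then have "finite (edges G)"
    using assms finite_subset by (auto simp: simple_graph_def)
  then have "{M. matching G M \<and> card M = 0} = {{}}"
    by (auto simp: matching_def card_eq_0_iff dest: finite_subset)
  then show ?thesis
    by (simp add: num_matchings_def)
qed

end

(*
  Deleting an edge e = uv gives M_G = M_(G-e) - M_(G-u-v).  Hence
  M_(P_(n+2)) = x M_(P_(n+1)) - M_(P_n) and M_(C_n) = M_(P_n) - M_(P_(n-2)).
  On the other side, let A_n and B_n be the even and odd binomial parts of (x + sqrt y)^n, so that
  (x + sqrt y)^n = A_n + sqrt y B_n.  With y = x^2 - 4 the numbers x + sqrt y and x - sqrt y have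
  sum 2x and product 4, so B_(n+2) = 2x B_(n+1) - 4 B_n, and A_n = x B_n - 4 B_(n-1).
*)
theory Submission
  imports Defs
begin

section \<open>Even and odd binomial parts\<close>

definition even_part :: "'a::comm_ring_1 \<Rightarrow> 'a \<Rightarrow> nat \<Rightarrow> 'a" where
  "even_part x y n = (\<Sum>k=0..n div 2. of_nat (n choose (2 * k)) * x ^ (n - 2 * k) * y ^ k)"

text \<open>The range is generous: once 2k + 1 > n the binomial vanishes, so truncated exponents do
  no harm. For n = 0 the sum is empty.\<close>

definition odd_part :: "'a::comm_ring_1 \<Rightarrow> 'a \<Rightarrow> nat \<Rightarrow> 'a" where
  "odd_part x y n = (\<Sum>k<n. of_nat (n choose (2 * k + 1)) * x ^ (n - Suc (2 * k)) * y ^ k)"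

text \<open>Binomials beyond the range are zero. The free upper bound lets sums for n and n + 1 be
  compared over one index set.\<close>

lemma even_part_extend:
  assumes "n div 2 \<le> N"
  shows "even_part x y n = (\<Sum>k\<le>N. of_nat (n choose (2 * k)) * x ^ (n - 2 * k) * y ^ k)"
  unfolding even_part_def
  using assms by (intro sum.mono_neutral_left) (auto simp: binomial_eq_0)

text \<open>This is the shape in which the odd part occurs in the path formula.\<close>

lemma odd_part_Suc_eq:
  "odd_part x y (Suc n) =
     (\<Sum>k=0..n div 2. of_nat ((n + 1) choose (2 * k + 1)) * x ^ (n - 2 * k) * y ^ k)"
  unfolding odd_part_def
  by (intro sum.mono_neutral_cong_right) (auto simp: binomial_eq_0 simp del: binomial_Suc_Suc)

lemma odd_part_extend:
  assumes "n \<le> N"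
  shows "odd_part x y n = (\<Sum>k<N. of_nat (n choose (2 * k + 1)) * x ^ (n - Suc (2 * k)) * y ^ k)"
  unfolding odd_part_def
  using assms by (intro sum.mono_neutral_left) (auto simp: binomial_eq_0)

text \<open>Truncated subtraction spoils the exponent only for j > n, where the binomial is
  zero.\<close>

lemma binomial_mult_power_Suc:
  "of_nat (n choose j) * x ^ (Suc n - j) = x * (of_nat (n choose j) * x ^ (n - j) :: 'a::comm_ring_1)"
  by (cases "j \<le> n") (auto simp: Suc_diff_le binomial_eq_0 ac_simps)

text \<open>This is the part free of sqrt y in (x + sqrt y)(A_n + sqrt y B_n).\<close>

lemma even_part_Suc: "even_part x y (Suc n) = x * even_part x y n + y * odd_part x y n"
proof -
  \<comment> \<open>The term k = 0 is split off, so that Pascal's rule applies to all the others; it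
    later returns as x times the first term of A_n.\<close>
  have "even_part x y (Suc n) =
      x ^ Suc n + (\<Sum>k<Suc n. of_nat (Suc n choose (2 * Suc k)) * x ^ (Suc n - 2 * Suc k) * y ^ Suc k)"
    by (subst even_part_extend[of _ "Suc n"])
      (simp_all add: sum.atMost_shift del: binomial_Suc_Suc sum.lessThan_Suc)
  also have "(\<Sum>k<Suc n. of_nat (Suc n choose (2 * Suc k)) * x ^ (Suc n - 2 * Suc k) * y ^ Suc k) =
      (\<Sum>k<Suc n. y * (of_nat (n choose (2 * k + 1)) * x ^ (n - Suc (2 * k)) * y ^ k)) +
      (\<Sum>k<Suc n. of_nat (n choose (2 * Suc k)) * x ^ (Suc n - 2 * Suc k) * y ^ Suc k)"
    unfolding sum.distrib[symmetric]
    by (intro sum.cong) (simp_all add: algebra_simps)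
  also have "(\<Sum>k<Suc n. of_nat (n choose (2 * Suc k)) * x ^ (Suc n - 2 * Suc k) * y ^ Suc k) =
      (\<Sum>k<Suc n. x * (of_nat (n choose (2 * Suc k)) * x ^ (n - 2 * Suc k) * y ^ Suc k))"
    by (simp only: binomial_mult_power_Suc mult.assoc[symmetric])
  also have "x ^ Suc n + ((\<Sum>k<Suc n. y * (of_nat (n choose (2 * k + 1)) * x ^ (n - Suc (2 * k)) * y ^ k)) +
      (\<Sum>k<Suc n. x * (of_nat (n choose (2 * Suc k)) * x ^ (n - 2 * Suc k) * y ^ Suc k))) =
      x * (\<Sum>k\<le>Suc n. of_nat (n choose (2 * k)) * x ^ (n - 2 * k) * y ^ k) + y * odd_part x y n"
    by (simp add: sum.atMost_shift odd_part_extend[of n "Suc n"] sum_distrib_left distrib_left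
        del: sum.lessThan_Suc)
  also have "(\<Sum>k\<le>Suc n. of_nat (n choose (2 * k)) * x ^ (n - 2 * k) * y ^ k) = even_part x y n"
    by (rule even_part_extend[symmetric]) simp
  finally show ?thesis .
qed

text \<open>This is the coefficient of sqrt y in the same product. Lower indices 2k + 1 are
  positive, so Pascal's rule applies to every term.\<close>

lemma odd_part_Suc: "odd_part x y (Suc n) = even_part x y n + x * odd_part x y n"
proof -
  have "odd_part x y (Suc n) =
      (\<Sum>k<Suc n. of_nat (n choose (2 * k)) * x ^ (n - 2 * k) * y ^ k) +
      (\<Sum>k<Suc n. of_nat (n choose (2 * k + 1)) * x ^ (Suc n - (2 * k + 1)) * y ^ k)"
    unfolding odd_part_def sum.distrib[symmetric]
    by (intro sum.cong) (simp_all add: algebra_simps)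
  also have "(\<Sum>k<Suc n. of_nat (n choose (2 * k + 1)) * x ^ (Suc n - (2 * k + 1)) * y ^ k) =
      x * odd_part x y n"
    by (simp only: binomial_mult_power_Suc odd_part_extend[of n "Suc n"] sum_distrib_left
        mult.assoc[symmetric]) simp
  also have "(\<Sum>k<Suc n. of_nat (n choose (2 * k)) * x ^ (n - 2 * k) * y ^ k) = even_part x y n"
    by (simp add: even_part_extend[of n n] lessThan_Suc_atMost del: sum.lessThan_Suc)
  finally show ?thesis .
qed

lemma odd_part_0: "odd_part x y 0 = 0"
  by (simp add: odd_part_def)

lemma even_part_0: "even_part x y 0 = 1"
  by (simp add: even_part_def)

section \<open>Second-order relations at y = x^2 - 4\<close>

text \<open>Eliminating A_n from the one-step rules gives 2x B_(n+1) + (y - x^2) B_n, and y - x^2 =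
  -4.\<close>

lemma odd_part_recurrence:
  "odd_part x (x\<^sup>2 - 4) (Suc (Suc n)) =
     2 * x * odd_part x (x\<^sup>2 - 4) (Suc n) - 4 * odd_part x (x\<^sup>2 - 4) n"
  by (simp add: odd_part_Suc even_part_Suc algebra_simps power2_eq_square)

text \<open>Since B_(n+2) = A_(n+1) + x B_(n+1), it suffices that x B_(n+1) - 4 B_n = x A_n + (x^2 -
  4) B_n = A_(n+1).\<close>

lemma even_part_eq_odd_part:
  "odd_part x (x\<^sup>2 - 4) (Suc (Suc n)) - 4 * odd_part x (x\<^sup>2 - 4) n =
     2 * even_part x (x\<^sup>2 - 4) (Suc n)"
  by (simp add: odd_part_Suc even_part_Suc algebra_simps power2_eq_square)

section \<open>Matching polynomials and edge deletion\<close>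

definition delete_edge :: "'a ugraph \<Rightarrow> 'a set \<Rightarrow> 'a ugraph" where
  "delete_edge G e = \<lparr>verts = verts G, edges = edges G - {e}\<rparr>"

definition delete_verts :: "'a ugraph \<Rightarrow> 'a set \<Rightarrow> 'a ugraph" where
  "delete_verts G S = \<lparr>verts = verts G - S, edges = {e \<in> edges G. disjnt e S}\<rparr>"

text \<open>Relabelling serves the cycle: removing the ends of its closing edge leaves a path whose
  vertices start at 1.\<close>

definition map_graph :: "('a \<Rightarrow> 'b) \<Rightarrow> 'a ugraph \<Rightarrow> 'b ugraph" where
  "map_graph f G = \<lparr>verts = f ` verts G, edges = image f ` edges G\<rparr>"

lemma simple_graph_delete_edge: "simple_graph G \<Longrightarrow> simple_graph (delete_edge G e)"
  by (auto simp: simple_graph_def delete_edge_def)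

lemma simple_graph_delete_verts: "simple_graph G \<Longrightarrow> simple_graph (delete_verts G S)"
  by (auto simp: simple_graph_def delete_verts_def disjnt_def)

lemma simple_graph_map: "inj f \<Longrightarrow> simple_graph G \<Longrightarrow> simple_graph (map_graph f G)"
  by (auto simp: simple_graph_def map_graph_def card_image inj_on_subset)

lemma finite_edges:
  assumes "simple_graph G"
  shows "finite (edges G)"
proof -
  have "edges G \<subseteq> Pow (verts G)"
    using assms by (auto simp: simple_graph_def)
  then show ?thesis
    using assms finite_subset by (auto simp: simple_graph_def)
qed

lemma finite_matching: "simple_graph G \<Longrightarrow> matching G M \<Longrightarrow> finite M"
  by (meson finite_edges finite_subset matching_def)

lemma finite_matchings: "simple_graph G \<Longrightarrow> finite {M. matching G M}"
  by (rule finite_subset[of _ "Pow (edges G)"]) (auto simp: matching_def finite_edges)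

text \<open>Disjoint two-element edges cover 2 |M| vertices. Hence exponents n - 2 |M| are never
  truncated.\<close>

lemma card_matching_le:
  assumes "simple_graph G" "matching G M"
  shows "card M \<le> card (verts G) div 2"
proof -
  have E: "e \<subseteq> verts G" "card e = 2" if "e \<in> M" for e
    using that assms by (auto simp: simple_graph_def matching_def)
  have "finite (verts G)"
    using assms by (simp add: simple_graph_def)
  have "card (\<Union>M) = (\<Sum>e\<in>M. card e)"
    using assms E \<open>finite (verts G)\<close>
    by (intro card_Union_disjoint) (auto simp: matching_def intro: finite_subset)
  also have "\<dots> = 2 * card M"
    using E by simp
  finally have "2 * card M \<le> card (verts G)"
    using card_mono[of "verts G" "\<Union>M"] E \<open>finite (verts G)\<close> by auto
  then show ?thesis
    by simp
qed

text \<open>Matchings are grouped by size. In this form, bijections between sets of matchings act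
  directly on the polynomial.\<close>

lemma matching_poly_eq_sum_matchings:
  assumes "simple_graph G"
  shows "matching_poly G = (\<Sum>M | matching G M. monom ((-1) ^ card M) (card (verts G) - 2 * card M))"
proof -
  let ?n = "card (verts G)"
  have "(\<Sum>M | matching G M. monom ((-1 :: real) ^ card M) (?n - 2 * card M)) =
      (\<Sum>k=0..?n div 2. \<Sum>M | M \<in> {M. matching G M} \<and> card M = k.
         monom ((-1) ^ card M) (?n - 2 * card M))"
    using assms by (intro sum.group[symmetric]) (auto simp: finite_matchings card_matching_le)
  also have "\<dots> = (\<Sum>k=0..?n div 2. monom ((-1) ^ k * real (num_matchings G k)) (?n - 2 * k))"
  proof (intro sum.cong refl)
    fix k
    have "(\<Sum>M | M \<in> {M. matching G M} \<and> card M = k. monom ((-1 :: real) ^ card M) (?n - 2 * card M)) =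
        (\<Sum>M | matching G M \<and> card M = k. monom ((-1) ^ k) (?n - 2 * k))"
      by (intro sum.cong) auto
    also have "\<dots> = monom ((-1) ^ k * real (num_matchings G k)) (?n - 2 * k)"
      by (simp add: num_matchings_def of_nat_poly flip: smult_monom) (simp add: smult_monom)
    finally show "(\<Sum>M | M \<in> {M. matching G M} \<and> card M = k. monom ((-1 :: real) ^ card M) (?n - 2 * card M)) =
        monom ((-1) ^ k * real (num_matchings G k)) (?n - 2 * k)" .
  qed
  finally show ?thesis
    by (simp add: matching_poly_def Let_def)
qed

text \<open>Matchings without e are those of G - e; matchings with e arise by adding e to a matching
  that avoids both its ends.\<close>

lemma matching_poly_delete_edge:
  assumes G: "simple_graph G" and e: "e \<in> edges G"
  shows "matching_poly G = matching_poly (delete_edge G e) - matching_poly (delete_verts G e)"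
proof -
  let ?n = "card (verts G)"
  let ?w = "\<lambda>M. monom ((-1 :: real) ^ card M) (?n - 2 * card M)"
  let ?D = "{M. matching (delete_edge G e) M}"
  let ?C = "{M. matching (delete_verts G e) M}"
  note simple = simple_graph_delete_edge[OF G, of e] simple_graph_delete_verts[OF G, of e]
  have e2: "card e = 2" "e \<subseteq> verts G" "finite e" "e \<noteq> {}"
    using G e by (auto simp: simple_graph_def intro: finite_subset)
  \<comment> \<open>A nonempty e is not disjoint from itself. So inserting e is injective and adds
    exactly one edge.\<close>
  have notin: "e \<notin> M" if "M \<in> ?C" for M
    using that e2 by (auto simp: matching_def delete_verts_def disjnt_def)
  have split: "{M. matching G M} = ?D \<union> insert e ` ?C"
  proof (intro equalityI subsetI)
    fix M assume M: "M \<in> {M. matching G M}"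
    show "M \<in> ?D \<union> insert e ` ?C"
    proof (cases "e \<in> M")
      case True
      then have "M - {e} \<in> ?C"
        using M by (auto simp: matching_def delete_verts_def pairwise_def)
      then show ?thesis
        using True by (auto intro!: image_eqI[of _ _ "M - {e}"])
    next
      case False
      then show ?thesis
        using M by (auto simp: matching_def delete_edge_def)
    qed
  next
    fix M assume "M \<in> ?D \<union> insert e ` ?C"
    then show "M \<in> {M. matching G M}"
    proof
      assume "M \<in> insert e ` ?C"
      then obtain N where N: "M = insert e N" "N \<subseteq> edges G" "pairwise disjnt N"
          "\<forall>y\<in>N. disjnt y e"
        by (auto simp: matching_def delete_verts_def)
      then show ?thesis
        using e by (simp add: matching_def pairwise_insert) (meson disjnt_sym)
    qed (auto simp: matching_def delete_edge_def)
  qed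
  have inj: "inj_on (insert e) ?C"
    by (metis inj_onI insert_ident notin)
  \<comment> \<open>The extra edge flips the sign; the exponent is kept, as n - 2(|M| + 1) = (n - 2)
    - 2 |M|.\<close>
  have w: "?w (insert e M) = - monom ((-1) ^ card M) (card (verts (delete_verts G e)) - 2 * card M)"
    if "M \<in> ?C" for M
    using notin[OF that] finite_matching[OF simple(2), of M] that e2
    by (simp add: delete_verts_def card_Diff_subset minus_monom)
  have "matching_poly G = sum ?w ?D + sum ?w (insert e ` ?C)"
    unfolding matching_poly_eq_sum_matchings[OF G] split
    by (intro sum.union_disjoint)
      (use simple in \<open>auto simp: finite_matchings matching_def delete_edge_def\<close>)
  also have "sum ?w (insert e ` ?C) = - matching_poly (delete_verts G e)"
    using w by (simp add: sum.reindex[OF inj] matching_poly_eq_sum_matchings[OF simple(2)]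
        sum_negf)
  also have "sum ?w ?D = matching_poly (delete_edge G e)"
    by (simp add: matching_poly_eq_sum_matchings[OF simple(1)]) (simp add: delete_edge_def)
  finally show ?thesis
    by simp
qed

text \<open>Both graphs have the same matchings; the additional vertex raises every exponent by
  one.\<close>

lemma matching_poly_isolated_vertex:
  assumes G: "simple_graph G" and v: "v \<in> verts G" "\<And>e. e \<in> edges G \<Longrightarrow> v \<notin> e"
  shows "matching_poly G = [:0, 1:] * matching_poly (delete_verts G {v})"
proof -
  let ?H = "delete_verts G {v}"
  have H: "simple_graph ?H"
    using G by (rule simple_graph_delete_verts)
  have matching_iff: "matching G = matching ?H"
    using v by (auto simp: matching_def delete_verts_def fun_eq_iff)
  have verts: "card (verts G) = Suc (card (verts ?H))"
    using card.remove[of "verts G" v] v G by (simp add: simple_graph_def delete_verts_def)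
  have "monom c (card (verts G) - 2 * card M) = [:0, 1:] * monom c (card (verts ?H) - 2 * card M)"
    if "matching ?H M" for M and c :: real
    using card_matching_le[OF H that] verts by (simp add: Suc_diff_le monom_Suc)
  then show ?thesis
    unfolding matching_poly_eq_sum_matchings[OF G] matching_poly_eq_sum_matchings[OF H]
      matching_iff sum_distrib_left
    by (intro sum.cong) auto
qed

text \<open>An injection acts on matchings as \<open>image (image f)\<close>, preserving
  disjointness of edges and all cardinalities.\<close>

lemma matching_poly_map:
  assumes f: "inj f" and G: "simple_graph G"
  shows "matching_poly (map_graph f G) = matching_poly G"
proof -
  have inj_image: "inj (image f)"
    using f by (auto intro: inj_on_image inj_on_subset)
  then have inj: "inj (image (image f))"
    by (auto intro: inj_on_image[of "image f"] inj_on_subset)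
  have disj: "disjnt (f ` A) (f ` B) \<longleftrightarrow> disjnt A B" for A B
    using f by (auto simp: disjnt_def inj_def)
  have "pairwise disjnt (image f ` M) \<longleftrightarrow> pairwise disjnt M" for M
    by (simp add: pairwise_image pairwise_def disj inj_eq[OF inj_image])
  then have matchings: "{M. matching (map_graph f G) M} = image (image f) ` {M. matching G M}"
    by (auto simp: matching_def map_graph_def subset_image_iff)
  have card: "card (image f ` M) = card M" for M
    using inj_image by (intro card_image) (auto intro: inj_on_subset)
  have "card (verts (map_graph f G)) = card (verts G)"
    using f by (simp add: map_graph_def card_image inj_on_subset)
  then show ?thesis
    unfolding matching_poly_eq_sum_matchings[OF G]
      matching_poly_eq_sum_matchings[OF simple_graph_map[OF f G]] matchings
    by (simp add: sum.reindex inj_on_subset[OF inj] card)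
qed

section \<open>Paths and cycles\<close>

lemma matching_poly_no_edges:
  assumes "simple_graph G" "edges G = {}"
  shows "matching_poly G = monom 1 (card (verts G))"
proof -
  have "{M. matching G M} = {{}}"
    using assms by (auto simp: matching_def)
  then show ?thesis
    using assms by (simp add: matching_poly_eq_sum_matchings)
qed

lemma matching_poly_path_0: "matching_poly (path_graph 0) = 1"
  using matching_poly_no_edges[OF simple_graph_path, of 0] by (simp add: path_graph_def)

lemma matching_poly_path_1: "matching_poly (path_graph (Suc 0)) = [:0, 1:]"
  using matching_poly_no_edges[OF simple_graph_path, of "Suc 0"]
  by (simp add: path_graph_def monom_altdef)

lemma matching_poly_path_Suc_Suc:
  "matching_poly (path_graph (Suc (Suc n))) =
     [:0, 1:] * matching_poly (path_graph (Suc n)) - matching_poly (path_graph n)"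
proof -
  let ?G = "path_graph (Suc (Suc n))"
  let ?e = "{n, Suc n}"
  have "?e \<in> edges ?G"
    by (auto simp: path_graph_def)
  then have "matching_poly ?G =
      matching_poly (delete_edge ?G ?e) - matching_poly (delete_verts ?G ?e)"
    by (rule matching_poly_delete_edge[OF simple_graph_path])
  also have "delete_verts ?G ?e = path_graph n"
    by (auto simp: delete_verts_def path_graph_def)
  \<comment> \<open>Without the last edge, the end vertex \<open>Suc n\<close> is isolated.\<close>
  also have "matching_poly (delete_edge ?G ?e) =
      [:0, 1:] * matching_poly (delete_verts (delete_edge ?G ?e) {Suc n})"
    by (intro matching_poly_isolated_vertex simple_graph_delete_edge simple_graph_path)
      (auto simp: delete_edge_def path_graph_def)
  also have "delete_verts (delete_edge ?G ?e) {Suc n} = path_graph (Suc n)"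
    by (auto simp: delete_verts_def delete_edge_def path_graph_def doubleton_eq_iff)
  finally show ?thesis .
qed

text \<open>The reduction modulo \<open>Suc n\<close> acts only at i = n, which yields the closing
  edge.\<close>

lemma edges_cycle:
  "edges (cycle_graph (Suc n)) = insert {n, 0} (edges (path_graph (Suc n)))"
proof -
  have "edges (cycle_graph (Suc n)) = (\<lambda>i. {i, Suc i mod Suc n}) ` {..<Suc n}"
    by (auto simp: cycle_graph_def)
  also have "\<dots> = insert {n, 0} ((\<lambda>i. {i, Suc i}) ` {..<n})"
    by (simp add: lessThan_Suc)
  also have "(\<lambda>i. {i, Suc i}) ` {..<n} = edges (path_graph (Suc n))"
    by (auto simp: path_graph_def)
  finally show ?thesis .
qed

lemma matching_poly_cycle:
  assumes "n \<ge> 1"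
  shows "matching_poly (cycle_graph (Suc (Suc n))) =
    matching_poly (path_graph (Suc (Suc n))) - matching_poly (path_graph n)"
proof -
  let ?G = "cycle_graph (Suc (Suc n))"
  let ?e = "{Suc n, 0}"
  have "simple_graph ?G"
    using assms by (intro simple_graph_cycle) simp
  then have "matching_poly ?G =
      matching_poly (delete_edge ?G ?e) - matching_poly (delete_verts ?G ?e)"
    by (rule matching_poly_delete_edge) (simp add: edges_cycle)
  \<comment> \<open>For n \<ge> 1 the closing edge is not a path edge, so deleting it leaves the
    path intact.\<close>
  also have "delete_edge ?G ?e = path_graph (Suc (Suc n))"
    using assms unfolding delete_edge_def edges_cycle
    by (auto simp: path_graph_def cycle_graph_def doubleton_eq_iff)
  also have "delete_verts ?G ?e = map_graph Suc (path_graph n)"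
  proof -
    have "{0..<Suc (Suc n)} - ?e = Suc ` {0..<n}"
      by (auto simp: image_Suc_atLeastLessThan)
    moreover have "{e \<in> edges ?G. disjnt e ?e} = image Suc ` edges (path_graph n)"
    proof -
      \<comment> \<open>A remaining edge {i, i + 1} is the shift of {i - 1, i}.\<close>
      have "{i, Suc i} \<in> image Suc ` {{i, Suc i} | i. Suc i < n}" if "i \<noteq> 0" "i < n" for i
        using that by (intro image_eqI[of _ _ "{i - 1, i}"]) (auto intro!: exI[of _ "i - 1"])
      then show ?thesis
        unfolding edges_cycle by (auto simp: path_graph_def)
    qed
    ultimately show ?thesis
      by (simp add: delete_verts_def map_graph_def cycle_graph_def path_graph_def)
  qed
  also have "matching_poly (map_graph Suc (path_graph n)) = matching_poly (path_graph n)"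
    by (intro matching_poly_map simple_graph_path) simp
  finally show ?thesis .
qed

section \<open>Matching polynomials as binomial parts\<close>

text \<open>Scaling by 2^n turns the path recurrence into that of the odd parts; the initial values
  1 and 2x are B_1 and B_2, whence the index shift.\<close>

lemma matching_poly_path_eq_odd_part:
  "smult (2 ^ n) (matching_poly (path_graph n)) = odd_part [:0, 1:] ([:0, 1:]\<^sup>2 - 4) (Suc n)"
proof (induction n rule: induct_nat_012)
  case 0
  show ?case
    by (simp add: matching_poly_path_0 odd_part_Suc odd_part_0 even_part_0)
next
  case 1
  show ?case
    by (simp add: matching_poly_path_1 odd_part_Suc even_part_Suc odd_part_0 even_part_0)
next
  case (ge2 n)
  have two: "smult 2 p = 2 * p" and four: "smult 4 p = 4 * p" for p :: "real poly"
    by (simp_all add: numeral_poly)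
  have "smult (2 ^ Suc (Suc n)) (matching_poly (path_graph (Suc (Suc n)))) =
      smult 2 ([:0, 1:] * smult (2 ^ Suc n) (matching_poly (path_graph (Suc n)))) -
      smult 4 (smult (2 ^ n) (matching_poly (path_graph n)))"
    by (simp add: matching_poly_path_Suc_Suc smult_diff_right)
  also have "\<dots> = odd_part [:0, 1:] ([:0, 1:]\<^sup>2 - 4) (Suc (Suc (Suc n)))"
    unfolding ge2.IH odd_part_recurrence[of _ "Suc n"] two four by (simp only: mult.assoc)
  finally show ?case .
qed

lemma matching_poly_cycle_eq_even_part:
  assumes "n \<ge> 1"
  shows "smult (2 ^ Suc n) (matching_poly (cycle_graph (Suc (Suc n)))) =
    even_part [:0, 1:] ([:0, 1:]\<^sup>2 - 4) (Suc (Suc n))"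
proof -
  have two: "smult 2 p = 2 * p" and four: "smult 4 p = 4 * p" for p :: "real poly"
    by (simp_all add: numeral_poly)
  \<comment> \<open>The relation between the parts yields 2 A_(n+2), so both sides are doubled and
    the 2 is cancelled at the end.\<close>
  have "smult 2 (smult (2 ^ Suc n) (matching_poly (cycle_graph (Suc (Suc n))))) =
      smult (2 ^ Suc (Suc n)) (matching_poly (path_graph (Suc (Suc n)))) -
      smult 4 (smult (2 ^ n) (matching_poly (path_graph n)))"
    using assms by (simp add: matching_poly_cycle smult_diff_right)
  also have "\<dots> = smult 2 (even_part [:0, 1:] ([:0, 1:]\<^sup>2 - 4) (Suc (Suc n)))"
    unfolding matching_poly_path_eq_odd_part two four by (rule even_part_eq_odd_part)
  finally show ?thesis
    by (metis smult_smult smult_1_left left_inverse zero_neq_numeral)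
qed

text \<open>The alternating sign is absorbed by replacing 4 - x with x - 4. It is applied with the
  square of the indeterminate as x.\<close>

lemma smult_alternating_eq:
  "smult ((-1) ^ k * real b) (p * (4 - x) ^ k) = of_nat b * p * (x - 4) ^ k"
proof -
  have "(x - 4) ^ k = smult ((-1) ^ k) ((4 - x) ^ k)"
    by (simp flip: smult_power)
  then show ?thesis
    by (simp add: of_nat_poly mult.commute)
qed

theorem mainTheorem9:
  shows "(\<forall>n\<ge>1. matching_poly (path_graph n) =
      smult (1 / 2 ^ n) (\<Sum>k=0..n div 2.
        smult ((-1) ^ k * real ((n + 1) choose (2 * k + 1)))
          ([:0, 1:] ^ (n - 2 * k) * (4 - [:0, 1:] ^ 2) ^ k))) \<and>
    (\<forall>n\<ge>3. matching_poly (cycle_graph n) =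
      smult (1 / 2 ^ (n - 1)) (\<Sum>k=0..n div 2.
        smult ((-1) ^ k * real (n choose (2 * k)))
          ([:0, 1:] ^ (n - 2 * k) * (4 - [:0, 1:] ^ 2) ^ k)))"
proof (intro conjI allI impI)
  fix n :: nat
  show "matching_poly (path_graph n) =
      smult (1 / 2 ^ n) (\<Sum>k=0..n div 2.
        smult ((-1) ^ k * real ((n + 1) choose (2 * k + 1)))
          ([:0, 1:] ^ (n - 2 * k) * (4 - [:0, 1:] ^ 2) ^ k))"
    unfolding smult_alternating_eq odd_part_Suc_eq[symmetric]
      matching_poly_path_eq_odd_part[symmetric] by simp
next
  fix n :: nat
  assume "n \<ge> 3"
  \<comment> \<open>With n = m + 2, the factor 2^(n-1) is the 2^(m+1) of the cycle identity.\<close>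
  then obtain m where m: "n = Suc (Suc m)" "m \<ge> 1"
    by (metis Suc_le_D Suc_le_mono numeral_3_eq_3 One_nat_def)
  show "matching_poly (cycle_graph n) =
      smult (1 / 2 ^ (n - 1)) (\<Sum>k=0..n div 2.
        smult ((-1) ^ k * real (n choose (2 * k)))
          ([:0, 1:] ^ (n - 2 * k) * (4 - [:0, 1:] ^ 2) ^ k))"
    unfolding smult_alternating_eq even_part_def[symmetric] m(1)
      matching_poly_cycle_eq_even_part[OF m(2), symmetric] by simp
qed

end
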